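(* For every integer $k \ge 186$ and every connected simple undirected graph $G$, for any choice of $S_k(G)$ and $T(G)$, $$\operatorname{leaf}(S_k(G) \cup T(G)) \ge \left(1-30\cdot\frac{1+\ln (k+1)}{k+1}\right)\operatorname{leaf}(G).$$
   Context: $\operatorname{leaf}(G)$ is the maximum number of leaves (nodes of degree one) of a spanning tree of $G$. $S_k(G)$ denotes any subgraph of $G$ that contains all nodes of $G$ and in which every node $x$ has degree at least $\min\{\deg_G(x), k\}$. $T(G)$ denotes any spanning tree of $G$. $S_k(G)\cup T(G)$ is the union subgraph (node set $V(G)$, edge set the union of the edge sets). *)

theory Defs
  imports Complex_Main "Graph_Theory.Graph_Theory"
begin

text \<open>
  A simple undirected graph is an instance of the locale \<open>graph\<close>: a finite, loop-free, symmetric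
  digraph without parallel arcs, each undirected edge being a pair of opposite arcs. The degree of
  a node is therefore its \<open>out_degree\<close>.

  The constants \<open>forest\<close>, \<open>tree\<close> and \<open>spanning_tree\<close> of \<open>Digraph_Component\<close> are not usable here:
  they exclude all directed cycles, among them the two arcs of a single undirected edge. In a
  \<open>graph\<close>, the undirected cycles are the directed cycles of length at least 3.
\<close>

definition undirected_acyclic :: "('a, 'b) pre_digraph \<Rightarrow> bool" where
  "undirected_acyclic G \<longleftrightarrow> \<not> (\<exists>p. pre_digraph.cycle G p \<and> 3 \<le> length p)"

definition undirected_tree :: "('a, 'b) pre_digraph \<Rightarrow> bool" where
  "undirected_tree T \<longleftrightarrow> graph T \<and> Digraph_Component.connected T \<and> undirected_acyclic T"

definition undirected_spanning_tree :: "('a, 'b) pre_digraph \<Rightarrow> ('a, 'b) pre_digraph \<Rightarrow> bool" where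
  "undirected_spanning_tree T G \<longleftrightarrow> undirected_tree T \<and> spanning T G"

definition leaves :: "('a, 'b) pre_digraph \<Rightarrow> 'a set" where
  "leaves T = {v \<in> verts T. out_degree T v = 1}"

text \<open>Meaningful for connected graphs only, since otherwise there is no spanning tree.\<close>

definition leaf :: "('a, 'b) pre_digraph \<Rightarrow> nat" where
  "leaf G = Max {card (leaves T) | T. undirected_spanning_tree T G}"

definition min_degree_subgraph ::
    "nat \<Rightarrow> ('a, 'b) pre_digraph \<Rightarrow> ('a, 'b) pre_digraph \<Rightarrow> bool" where
  "min_degree_subgraph k S G \<longleftrightarrow>
     graph S \<and> spanning S G \<and> (\<forall>x \<in> verts G. min (out_degree G x) k \<le> out_degree S x)"

end

theory Submission
  imports Defs
begin

text \<open>
  Put \<open>d = k + 1\<close> and let \<open>B\<close> be the set of nodes of degree more than \<open>k\<close> in \<open>G\<close>, so that every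
  edge with an end outside \<open>B\<close> belongs to \<open>S\<close>. Let \<open>U\<close> be the closed neighbourhood of \<open>B\<close> in \<open>S\<close>. The
  greedy algorithm yields a set \<open>D\<close> with at most \<open>card U * (2 + ln d) / d\<close> elements that dominates \<open>B\<close>
  in \<open>S\<close>.

  In a connected graph, if \<open>A\<close> induces at most \<open>c\<close> components and every node of \<open>W\<close>, disjoint from
  \<open>A\<close>, has a neighbour in \<open>A\<close>, then there is a spanning tree with at least \<open>card W - 2 * (c - 1)\<close>
  leaves. Applied to \<open>G\<close> with \<open>A = D\<close>, \<open>W = B - D\<close> and with \<open>A = B\<close>, \<open>W = U - B\<close>, this gives
  \<open>card B \<le> leaf G + 3 * card D\<close> and \<open>card U \<le> leaf G + 3 * card B\<close>, hence
  \<open>3 * card U \<le> 20 * leaf G\<close> when \<open>d \<ge> 187\<close>. Applied to the union of \<open>S\<close> and \<open>T\<close>, with \<open>A\<close> consisting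
  of \<open>D\<close> and the inner nodes of an optimal spanning tree of \<open>G\<close>, it gives a spanning tree that loses
  at most \<open>3 * card D\<close> leaves.
\<close>

section \<open>Greedy hitting sets\<close>

text \<open>By double counting, some element of \<open>U\<close> lies in at least a
  \<open>d / card U\<close> share of the sets not yet hit. Picking it shrinks their number by the
  factor \<open>1 - d / card U\<close>; after \<open>j\<close> picks, one element is added for each
  set that is left.\<close>

lemma hitting_set_greedy:
  fixes F :: "'i \<Rightarrow> 'a set" and d j :: nat
  assumes "finite U" "finite I" "\<And>i. i \<in> I \<Longrightarrow> F i \<subseteq> U \<and> d \<le> card (F i)" "0 < d"
  shows "\<exists>D\<subseteq>U. (\<forall>i\<in>I. F i \<inter> D \<noteq> {}) \<and>
           real (card D) \<le> real j + real (card I) * (1 - real d / real (card U)) ^ j"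
  using assms(2,3)
proof (induction j arbitrary: I)
  case 0
  have "\<forall>i\<in>I. \<exists>x. x \<in> F i"
    using 0 assms(4) by (metis card.empty equals0I not_le)
  then obtain c where c: "\<forall>i\<in>I. c i \<in> F i" by metis
  have "card (c ` I) \<le> card I" using 0 by (simp add: card_image_le)
  then show ?case using c 0 by (intro exI[of _ "c ` I"]) auto
next
  case (Suc j)
  show ?case
  proof (cases "I = {}")
    case True
    then show ?thesis by (intro exI[of _ "{}"]) auto
  next
    case False
    then obtain i where "i \<in> I" by auto
    then have dU: "d \<le> card U" using Suc.prems(2)[of i] assms(1) card_mono le_trans by metis
    have "\<exists>u\<in>U. card I * d \<le> card U * card {i \<in> I. u \<in> F i}"
    proof (rule ccontr)
      assume neg: "\<not> ?thesis"
      \<comment> \<open>Incidences between \<open>I\<close> and \<open>U\<close>, counted both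
        ways.\<close>
      have "(\<Sum>i\<in>I. card {u \<in> U. u \<in> F i}) = (\<Sum>u\<in>U. card {i \<in> I. u \<in> F i})"
        using assms(1) Suc.prems(1) sum.swap_restrict[of I U "\<lambda>_ _. 1::nat" "\<lambda>i u. u \<in> F i"]
        by simp
      moreover have "(\<Sum>i\<in>I. card {u \<in> U. u \<in> F i}) \<ge> (\<Sum>i\<in>I. d)"
      proof (rule sum_mono)
        fix i assume "i \<in> I"
        then have "{u \<in> U. u \<in> F i} = F i" using Suc.prems(2) by auto
        then show "d \<le> card {u \<in> U. u \<in> F i}" using Suc.prems(2) \<open>i \<in> I\<close> by simp
      qed
      ultimately have le: "card I * d \<le> (\<Sum>u\<in>U. card {i \<in> I. u \<in> F i})" by simp
      have "U \<noteq> {}" using dU assms(4) by auto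
      then have "(\<Sum>u\<in>U. card U * card {i \<in> I. u \<in> F i}) < (\<Sum>u\<in>U. card I * d)"
        using neg assms(1) by (intro sum_strict_mono) auto
      then have "card U * (\<Sum>u\<in>U. card {i \<in> I. u \<in> F i}) < card U * (card I * d)"
        by (simp add: sum_distrib_left)
      then show False using le by auto
    qed
    then obtain u where u: "u \<in> U" "card I * d \<le> card U * card {i \<in> I. u \<in> F i}" by auto
    let ?J = "{i \<in> I. u \<notin> F i}"
    have "\<exists>D\<subseteq>U. (\<forall>i\<in>?J. F i \<inter> D \<noteq> {}) \<and>
           real (card D) \<le> real j + real (card ?J) * (1 - real d / real (card U)) ^ j"
      using Suc.prems by (intro Suc.IH) auto
    then obtain D where D: "D \<subseteq> U" "\<forall>i\<in>?J. F i \<inter> D \<noteq> {}"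
      "real (card D) \<le> real j + real (card ?J) * (1 - real d / real (card U)) ^ j" by auto
    have cU: "real (card U) > 0" using dU assms(4) by simp
    have "card I = card ?J + card {i \<in> I. u \<in> F i}"
      using Suc.prems(1) by (subst card_Un_disjoint[symmetric]) (auto intro!: arg_cong[of _ _ card])
    moreover have "real (card I) * real d / real (card U) \<le> real (card {i \<in> I. u \<in> F i})"
      using u(2) cU by (simp add: divide_le_eq mult.commute flip: of_nat_mult)
    ultimately have "real (card ?J) \<le> real (card I) * (1 - real d / real (card U))"
      by (simp add: right_diff_distrib)
    moreover have "0 \<le> (1 - real d / real (card U)) ^ j" using dU cU by simp
    ultimately have "real (card ?J) * (1 - real d / real (card U)) ^ j
        \<le> real (card I) * (1 - real d / real (card U)) ^ Suc j"
      unfolding power_Suc mult.assoc[symmetric] by (rule mult_right_mono)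
    moreover have "card (insert u D) \<le> Suc (card D)" by (rule card_insert_le_m1) simp_all
    ultimately have "real (card (insert u D)) \<le>
        real (Suc j) + real (card I) * (1 - real d / real (card U)) ^ Suc j"
      using D(3) by linarith
    then show ?thesis using D u(1) by (intro exI[of _ "insert u D"]) auto
  qed
qed

text \<open>Picks are balanced against leftovers: with \<open>n = card U\<close>, about
  \<open>n * ln d / d\<close> picks leave at most \<open>n / d\<close> sets. The \<open>2\<close>
  pays for those and for rounding the number of picks up, which costs
  \<open>1 \<le> n / d\<close>.\<close>

lemma hitting_set_log_bound:
  fixes F :: "'i \<Rightarrow> 'a set" and d :: nat
  assumes "finite U" "finite I" "I \<noteq> {}" "card I \<le> card U"
    and "\<And>i. i \<in> I \<Longrightarrow> F i \<subseteq> U \<and> d \<le> card (F i)" "0 < d"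
  shows "\<exists>D\<subseteq>U. (\<forall>i\<in>I. F i \<inter> D \<noteq> {}) \<and>
           real (card D) \<le> real (card U) * ((2 + ln (real d)) / real d)"
proof -
  obtain i where "i \<in> I" using assms(3) by auto
  then have dU: "d \<le> card U" using assms(1) assms(5)[of i] card_mono le_trans by metis
  define n where "n = real (card U)"
  have n: "n > 0" "real d \<le> n" using dU assms(6) by (auto simp: n_def)
  define j where "j = nat \<lceil>n * ln d / d\<rceil>"
  have j: "n * ln d / d \<le> j" "j \<le> n * ln d / d + 1"
  proof -
    have "0 \<le> n * ln d / d" using n assms(6) by (intro divide_nonneg_pos mult_nonneg_nonneg) auto
    then show "n * ln d / d \<le> j" "j \<le> n * ln d / d + 1" unfolding j_def by linarith+
  qed
  have "(1 - real d / n) ^ j \<le> exp (- (real d / n)) ^ j"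
    using n exp_ge_add_one_self[of "- (real d / n)"] by (intro power_mono) auto
  also have "\<dots> = exp (- (real j * (real d / n)))"
    by (simp flip: exp_of_nat_mult)
  also have "\<dots> \<le> exp (- ln d)"
  proof -
    have "ln d = (n * ln d / d) * (d / n)" using n assms(6) by simp
    also have "\<dots> \<le> j * (d / n)" using j(1) n assms(6) by (intro mult_right_mono) auto
    finally show ?thesis by simp
  qed
  also have "\<dots> = 1 / d" using assms(6) by (simp add: exp_minus inverse_eq_divide)
  finally have pow: "(1 - real d / n) ^ j \<le> 1 / d" .
  obtain D where D: "D \<subseteq> U" "\<forall>i\<in>I. F i \<inter> D \<noteq> {}"
      "real (card D) \<le> real j + real (card I) * (1 - real d / real (card U)) ^ j"
    using hitting_set_greedy[OF assms(1,2) _ assms(6), of F j] assms(5) by auto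
  have "real (card I) * (1 - real d / n) ^ j \<le> n * (1 / d)"
    using pow assms(4) n by (intro mult_mono) (auto simp: n_def)
  moreover have "1 \<le> n / d" using n assms(6) by simp
  ultimately have "real (card D) \<le> n * ln d / d + n / d + n / d"
    using D(3) j(2) by (simp add: n_def)
  also have "\<dots> = n * ((2 + ln d) / d)" by (simp add: distrib_left add_divide_distrib)
  finally show ?thesis using D by (auto simp: n_def)
qed

section \<open>Spanning trees with many leaves\<close>

text \<open>Two classes of \<open>A\<close> at minimal distance are joined along a shortest path. An inner vertex of
  the path that is neither the first nor the last one has no neighbour in \<open>A\<close>, as this would give a
  closer pair of classes; so each of the \<open>card R - 1\<close> joins removes at most two elements of \<open>W\<close>.\<close>

lemma merge_classes:
  fixes E :: "'a rel"
  assumes "sym E" "E \<subseteq> V \<times> V" "\<And>u v. u \<in> V \<Longrightarrow> v \<in> V \<Longrightarrow> (u, v) \<in> E\<^sup>*"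
    and "finite R" "R \<subseteq> A" "A \<subseteq> V" "\<And>a. a \<in> A \<Longrightarrow> \<exists>r\<in>R. (a, r) \<in> rtrancl_on A E"
    and "finite W" "\<And>w. w \<in> W \<Longrightarrow> \<exists>a\<in>A. (w, a) \<in> E"
  shows "\<exists>A'. A \<subseteq> A' \<and> A' \<subseteq> V \<and> (\<forall>a\<in>A'. \<forall>b\<in>A'. (a, b) \<in> rtrancl_on A' E) \<and>
           card (W - A) \<le> card (W - A') + 2 * (card R - 1)"
  using assms(4-7,9)
proof (induction "card R" arbitrary: R A rule: less_induct)
  case less
  have symA: "(b, a) \<in> rtrancl_on A E" if "(a, b) \<in> rtrancl_on A E" for a b
    using that rtrancl_on_sym[OF assms(1), of A] by (auto dest: symD)
  show ?case
  proof (cases "\<forall>a\<in>A. \<forall>b\<in>A. (a, b) \<in> rtrancl_on A E")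
    case True
    then show ?thesis using less.prems by (intro exI[of _ A]) auto
  next
    case False
    \<comment> \<open>The least \<open>n\<close> with \<open>P n\<close> is the distance between two
      closest classes; the walk \<open>f\<close> realises it.\<close>
    define P where "P n \<longleftrightarrow> (\<exists>a\<in>A. \<exists>b\<in>A. (a, b) \<notin> rtrancl_on A E \<and> (a, b) \<in> E ^^ n)" for n
    have "\<exists>n. P n"
      using False less.prems(3) assms(3) unfolding P_def by (meson rtrancl_imp_relpow subsetD)
    then obtain m where m: "P m" "\<And>n. n < m \<Longrightarrow> \<not> P n" using exists_least_iff[of P] by auto
    then obtain a b where ab: "a \<in> A" "b \<in> A" "(a, b) \<notin> rtrancl_on A E" "(a, b) \<in> E ^^ m"
      unfolding P_def by auto
    then obtain f where f: "f 0 = a" "f m = b" "\<forall>i<m. (f i, f (Suc i)) \<in> E"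
      by (auto simp: relpow_fun_conv)
    have pre: "(a, f i) \<in> E ^^ i" if "i \<le> m" for i
      using that f by (auto simp: relpow_fun_conv intro!: exI[of _ f])
    have post: "(f i, b) \<in> E ^^ (m - i)" if "i \<le> m" for i
      using that f by (auto simp: relpow_fun_conv intro!: exI[of _ "\<lambda>j. f (i + j)"])
    have sep: "(a, c) \<notin> rtrancl_on A E \<or> (c, b) \<notin> rtrancl_on A E" for c
      using ab(3) rtrancl_on_trans by metis
    \<comment> \<open>A neighbour \<open>c\<close> of \<open>f i\<close> in \<open>A\<close> is
      outside the class of \<open>a\<close> or that of \<open>b\<close>, giving a walk between
      classes of length \<open>i + 1\<close> or \<open>m - i + 1\<close>. Both are less than
      \<open>m\<close> exactly when \<open>i + 2 \<le> m\<close> and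
      \<open>2 \<le> i\<close>.\<close>
    have far: False if "2 \<le> i" "i + 2 \<le> m" "c \<in> A" "(f i, c) \<in> E" for i c
    proof -
      have "(a, c) \<in> E ^^ Suc i" using pre[of i] that by auto
      moreover have "(c, b) \<in> E ^^ Suc (m - i)"
        using post[of i] that assms(1) by (intro relpow_Suc_I2[of c "f i"]) (auto dest: symD)
      ultimately have "P (Suc i) \<or> P (Suc (m - i))"
        using sep[of c] ab that unfolding P_def by blast
      then show False using m(2)[of "Suc i"] m(2)[of "Suc (m - i)"] that by auto
    qed
    define A2 where "A2 = A \<union> f ` {..m}"
    have fV: "f i \<in> V" if "i \<le> m" for i
    proof (cases i)
      case 0 then show ?thesis using f(1) ab(1) less.prems(3) by auto
    next
      case (Suc n)
      then have "(f n, f i) \<in> E" using f(3) that by auto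
      then show ?thesis using assms(2) by auto
    qed
    have "(f i, a) \<in> rtrancl_on A2 E" if "i \<le> m" for i
      using that
    proof (induction i)
      case 0 then show ?case using f ab by (auto simp: A2_def)
    next
      case (Suc i)
      then have "(f (Suc i), f i) \<in> E" using f(3) Suc.prems symD[OF assms(1), of "f i"] by auto
      moreover have "(f i, a) \<in> rtrancl_on A2 E" using Suc by simp
      moreover have "f (Suc i) \<in> A2" using Suc.prems by (auto simp: A2_def)
      ultimately show ?case by (rule converse_rtrancl_on_into_rtrancl_on)
    qed
    note path = this
    have mono: "(x, y) \<in> rtrancl_on A2 E" if "(x, y) \<in> rtrancl_on A E" for x y
      using that rtrancl_on_mono[of E E A A2] by (auto simp: A2_def)
    obtain r s where r: "r \<in> R" "(a, r) \<in> rtrancl_on A E" and s: "s \<in> R" "(b, s) \<in> rtrancl_on A E"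
      using less.prems(4) ab by meson
    have rs: "r \<noteq> s" using r s ab(3) symA rtrancl_on_trans by metis
    \<comment> \<open>The path puts \<open>s\<close> into the class of \<open>r\<close>, so
      \<open>R\<close> without \<open>s\<close> still represents all classes.\<close>
    have "\<exists>A'. A2 \<subseteq> A' \<and> A' \<subseteq> V \<and> (\<forall>a\<in>A'. \<forall>b\<in>A'. (a, b) \<in> rtrancl_on A' E) \<and>
           card (W - A2) \<le> card (W - A') + 2 * (card (R - {s}) - 1)"
    proof (rule less.hyps)
      show "card (R - {s}) < card R" using less.prems(1) s(1) by (rule card_Diff1_less)
      show "R - {s} \<subseteq> A2" using less.prems by (auto simp: A2_def)
      show "A2 \<subseteq> V" using less.prems fV by (auto simp: A2_def)
      show "\<exists>a\<in>A2. (w, a) \<in> E" if "w \<in> W" for w using less.prems(5) that by (auto simp: A2_def)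
      have ar: "(a, r) \<in> rtrancl_on A2 E" using mono r by auto
      fix c assume "c \<in> A2"
      then consider "c \<in> A" | i where "i \<le> m" "c = f i" by (auto simp: A2_def)
      then show "\<exists>r\<in>R - {s}. (c, r) \<in> rtrancl_on A2 E"
      proof cases
        case 1
        then obtain t where t: "t \<in> R" "(c, t) \<in> rtrancl_on A E" using less.prems(4) by auto
        show ?thesis
        proof (cases "t = s")
          case True
          then have "(c, b) \<in> rtrancl_on A E" using t s symA rtrancl_on_trans by metis
          then have "(c, b) \<in> rtrancl_on A2 E" by (rule mono)
          then have "(c, r) \<in> rtrancl_on A2 E" using path[of m] f(2) ar by (auto intro: rtrancl_on_trans)
          then show ?thesis using r rs by auto
        next
          case False then show ?thesis using t mono by auto
        qed
      next
        case 2
        then have "(c, r) \<in> rtrancl_on A2 E" using path ar by (auto intro: rtrancl_on_trans)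
        then show ?thesis using r rs by auto
      qed
    qed (use less.prems in auto)
    then obtain A' where A': "A2 \<subseteq> A'" "A' \<subseteq> V" "\<forall>a\<in>A'. \<forall>b\<in>A'. (a, b) \<in> rtrancl_on A' E"
      "card (W - A2) \<le> card (W - A') + 2 * (card (R - {s}) - 1)" by auto
    have "W - A \<subseteq> (W - A2) \<union> {f 1, f (m - 1)}"
    proof
      fix w assume w: "w \<in> W - A"
      show "w \<in> (W - A2) \<union> {f 1, f (m - 1)}"
      proof (cases "w \<in> A2")
        case True
        then obtain i where i: "i \<le> m" "w = f i" using w by (auto simp: A2_def)
        have "i \<noteq> 0" "i \<noteq> m" using i w f ab by (metis DiffD2)+
        moreover obtain c where "c \<in> A" "(w, c) \<in> E" using less.prems(5) w by auto
        ultimately have "i = 1 \<or> i = m - 1" using far[of i c] i by fastforce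
        then show ?thesis using i by auto
      qed (use w in auto)
    qed
    then have "card (W - A) \<le> card ((W - A2) \<union> {f 1, f (m - 1)})"
      using assms(8) by (intro card_mono) auto
    also have "\<dots> \<le> card (W - A2) + card {f 1, f (m - 1)}" by (rule card_Un_le)
    also have "\<dots> \<le> card (W - A2) + 2" by (simp add: card_insert_if)
    finally have "card (W - A) \<le> card (W - A2) + 2" .
    \<comment> \<open>There are at least two representatives, so the truncated
      \<open>card R - 1\<close> really drops by one.\<close>
    moreover have "card {r, s} \<le> card R" using r s less.prems by (intro card_mono) auto
    moreover have "card (R - {s}) = card R - 1" using s less.prems by simp
    ultimately have "card (W - A) \<le> card (W - A') + 2 * (card R - 1)"
      using A'(4) rs by auto
    then show ?thesis using A' by (intro exI[of _ A']) (auto simp: A2_def)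
  qed
qed

section \<open>Cycles as cyclic sequences of arcs\<close>

lemma (in pre_digraph) cas_nth:
  assumes "cas u p v" "Suc i < length p"
  shows "head G (p ! i) = tail G (p ! Suc i)"
  using assms
proof (induction p arbitrary: u i)
  case (Cons e es)
  then show ?case by (cases i; cases es) auto
qed simp

lemma (in pre_digraph) cas_ends:
  assumes "cas u p v" "p \<noteq> []"
  shows "tail G (p ! 0) = u" "head G (p ! (length p - 1)) = v"
  using assms
proof (induction p arbitrary: u)
  case (Cons e es)
  { case 1 then show ?case by simp }
  { case 2 then show ?case using Cons.IH by (cases es) auto }
qed simp_all

text \<open>Taking the index modulo \<open>length p\<close> covers the closing of the cycle, so
  every arc has a successor.\<close>

lemma (in pre_digraph) cycle_mod_nth:
  assumes "cycle p" "i < length p"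
  shows "head G (p ! i) = tail G (p ! (Suc i mod length p))"
proof -
  obtain u where u: "cas u p u" "p \<noteq> []" using assms by (auto simp: cycle_def awalk_def)
  show ?thesis
  proof (cases "Suc i < length p")
    case True then show ?thesis using cas_nth[OF u(1)] by simp
  next
    case False
    then have "i = length p - 1" "Suc i = length p" using assms(2) by auto
    then show ?thesis using cas_ends[OF u] by simp
  qed
qed

text \<open>Supplies the cyclic predecessor of an index, wrapping \<open>0\<close> around to
  \<open>m - 1\<close>.\<close>

lemma Suc_mod_surj:
  assumes "j < m"
  shows "\<exists>i<m. Suc i mod m = j"
  using assms by (intro exI[of _ "if j = 0 then m - 1 else j - 1"]) auto

lemma (in pre_digraph) cycle_distinct_heads:
  assumes "cycle p"
  shows "distinct (map (head G) p)"
  using assms by (auto simp: cycle_def awalk_def awalk_verts_conv' split: if_splits)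

text \<open>A vertex with a single neighbour \<open>u\<close> is entered from and left towards \<open>u\<close>; the heads of a
  cycle being distinct, such a cycle has length at most 2.\<close>

lemma (in pre_digraph) pendant_not_in_long_cycle:
  assumes "cycle p" "3 \<le> length p" "a \<in> set p"
    and in_v: "\<And>e. e \<in> set p \<Longrightarrow> head G e = v \<Longrightarrow> tail G e = u"
    and out_v: "\<And>e. e \<in> set p \<Longrightarrow> tail G e = v \<Longrightarrow> head G e = u"
  shows "head G a \<noteq> v"
proof
  assume av: "head G a = v"
  define m where "m = length p"
  have m: "3 \<le> m" using assms by (simp add: m_def)
  have inj: "i = j" if "i < m" "j < m" "head G (p ! i) = head G (p ! j)" for i j
    using that cycle_distinct_heads[OF assms(1)] by (auto simp: distinct_conv_nth m_def)
  obtain j where j: "j < m" "p ! j = a" using assms(3) by (auto simp: in_set_conv_nth m_def)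
  obtain i where i: "i < m" "Suc i mod m = j" using Suc_mod_surj j by blast
  let ?l = "Suc j mod m"
  have l: "?l < m" using m by simp
  have "tail G (p ! ?l) = v" using cycle_mod_nth[OF assms(1), of j] j av by (simp add: m_def)
  then have "head G (p ! ?l) = u" using out_v[of "p ! ?l"] l by (simp add: m_def)
  moreover have "head G (p ! i) = u"
    using cycle_mod_nth[OF assms(1), of i] i j in_v[of a] av assms(3) by (simp add: m_def)
  ultimately have "i = ?l" using inj i(1) l by simp
  \<comment> \<open>\<open>i\<close> precedes and \<open>?l\<close> follows \<open>j\<close> in the
    cyclic order; they agree only when \<open>m\<close> is at most 2.\<close>
  then show False using i j m by (auto simp: mod_Suc split: if_splits)
qed

section \<open>Growing trees by pendant edges\<close>

text \<open>The new node \<open>v\<close> has \<open>u\<close> as its only neighbour, so no long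
  cycle passes through it, and one in \<open>T'\<close> would already lie in \<open>T\<close>.
  Degrees change only at \<open>u\<close> and \<open>v\<close>, hence \<open>u\<close> is the only
  leaf that can be lost.\<close>

lemma undirected_tree_add_pendant:
  fixes X T :: "('a, 'b) pre_digraph"
  assumes X: "graph X" and T: "undirected_tree T" and sub: "subgraph T X"
    and u: "u \<in> verts T" and uv: "(u, v) \<in> arcs_ends X" and v: "v \<notin> verts T"
  shows "\<exists>T'. undirected_tree T' \<and> subgraph T' X \<and> verts T' = insert v (verts T) \<and>
           insert v (leaves T - {u}) \<subseteq> leaves T'"
proof -
  interpret X: graph X by (rule X)
  interpret T: graph T using T by (simp add: undirected_tree_def)
  have comp: "tail T = tail X" "head T = head X" "arcs T \<subseteq> arcs X" "verts T \<subseteq> verts X"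
    using sub by (auto simp: subgraph_def compatible_def)
  obtain e where e: "e \<in> arcs X" "tail X e = u" "head X e = v"
    using uv by (auto simp: arcs_ends_conv)
  obtain e' where e': "e' \<in> arcs X" "tail X e' = v" "head X e' = u"
    using X.graph_symmetric[OF uv] by (auto simp: arcs_ends_conv)
  have neq: "u \<noteq> v" using u v by auto
  define T' where "T' = \<lparr>verts = insert v (verts T), arcs = insert e (insert e' (arcs T)),
    tail = tail X, head = head X\<rparr>"
  have T'_simps [simp]: "verts T' = insert v (verts T)" "arcs T' = insert e (insert e' (arcs T))"
    "tail T' = tail X" "head T' = head X"
    by (simp_all add: T'_def)
  have Tv: "tail X a \<noteq> v" "head X a \<noteq> v" if "a \<in> arcs T" for a
    using T.tail_in_verts[OF that] T.head_in_verts[OF that] v comp by auto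
  have wf: "wf_digraph T'"
    using T.tail_in_verts T.head_in_verts comp e e' u by unfold_locales auto
  have sub': "subgraph T' X"
    using wf comp e e' X.head_in_verts[OF e(1)] X.wf_digraph
    by (auto simp: subgraph_def compatible_def)
  have "arcs T' \<subseteq> arcs X" using comp e e' by auto
  have ends: "arcs_ends T' = insert (u, v) (insert (v, u) (arcs_ends T))"
    using e e' comp by (auto simp: arcs_ends_conv)
  have graph': "graph T'"
  proof -
    interpret T': wf_digraph T' by (rule wf)
    have "symmetric T'"
      using T.sym_arcs unfolding symmetric_def ends by (auto simp: sym_def)
    then show ?thesis
      using \<open>arcs T' \<subseteq> arcs X\<close> X.no_loops X.no_multi_arcs
      by unfold_locales (auto simp: arc_to_ends_def subset_iff)
  qed
  have conn': "Digraph_Component.connected T'"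
  proof -
    interpret T': graph T' by (rule graph')
    have "strongly_connected T"
      using T T.sym_arcs by (intro T.symmetric_connected_imp_strongly_connected)
        (auto simp: undirected_tree_def)
    then have reachT: "x \<rightarrow>\<^sup>*\<^bsub>T\<^esub> y" if "x \<in> verts T" "y \<in> verts T" for x y
      using that by (auto simp: strongly_connected_def)
    have reach: "x \<rightarrow>\<^sup>*\<^bsub>T'\<^esub> y" if "x \<in> verts T" "y \<in> verts T" for x y
      using reachT[OF that] rtrancl_on_mono[of "arcs_ends T" "arcs_ends T'" "verts T" "verts T'" x y]
      unfolding reachable_def ends by auto
    have uv': "u \<rightarrow>\<^sup>*\<^bsub>T'\<^esub> v" "v \<rightarrow>\<^sup>*\<^bsub>T'\<^esub> u"
      using ends by auto
    have "strongly_connected T'"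
    proof (rule strongly_connectedI)
      fix x y assume "x \<in> verts T'" "y \<in> verts T'"
      then have "x \<rightarrow>\<^sup>*\<^bsub>T'\<^esub> u" "u \<rightarrow>\<^sup>*\<^bsub>T'\<^esub> y" using uv' reach u by auto
      then show "x \<rightarrow>\<^sup>*\<^bsub>T'\<^esub> y" by (rule T'.reachable_trans)
    qed simp
    \<comment> \<open>\<open>connected\<close> refers to the symmetric closure; reachability passes
      to it by monotonicity.\<close>
    moreover have "arcs_ends T' \<subseteq> (arcs_ends T')\<^sup>s" by (auto simp: symcl_def)
    note rtrancl_on_mono[OF this subset_refl]
    ultimately show ?thesis
      unfolding connected_conv strongly_connected_def reachable_def by blast
  qed
  have "undirected_acyclic T'"
    unfolding undirected_acyclic_def
  proof (intro notI, elim exE conjE)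
    fix p assume p: "pre_digraph.cycle T' p" "3 \<le> length p"
    then have arcs: "set p \<subseteq> arcs T'" by (auto simp: pre_digraph.cycle_def pre_digraph.awalk_def)
    have no_v: "head X a \<noteq> v" if "a \<in> set p" for a
      using pre_digraph.pendant_not_in_long_cycle[OF p that, of v u] arcs e e' Tv neq
      by fastforce
    \<comment> \<open>An arc leaving \<open>v\<close> would follow an arc entering \<open>v\<close>
      on the cycle.\<close>
    have no_v': "tail X a \<noteq> v" if "a \<in> set p" for a
    proof -
      obtain j where j: "j < length p" "p ! j = a" using \<open>a \<in> set p\<close> by (auto simp: in_set_conv_nth)
      obtain i where "i < length p" "Suc i mod length p = j" using Suc_mod_surj j by blast
      then show ?thesis
        using pre_digraph.cycle_mod_nth[OF p(1), of i] no_v[of "p ! i"] j by auto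
    qed
    have "set p \<subseteq> arcs T" using arcs no_v no_v' e e' by auto
    moreover obtain w where w: "pre_digraph.awalk T' w p w"
      "distinct (tl (pre_digraph.awalk_verts T' w p))" "p \<noteq> []"
      using p by (auto simp: pre_digraph.cycle_def)
    moreover have cc: "compatible T' T" using comp by (simp add: compatible_def)
    moreover have "w \<in> verts T"
      using w no_v' pre_digraph.cas_ends(1)[of T' w p w]
      by (auto simp: pre_digraph.awalk_def)
        (metis length_greater_0_conv nth_mem)
    ultimately have "pre_digraph.cycle T p"
      by (auto simp: pre_digraph.cycle_def pre_digraph.awalk_def
          compatible_cas[OF cc] compatible_awalk_verts[OF cc])
    then show False using T p(2) by (auto simp: undirected_tree_def undirected_acyclic_def)
  qed
  moreover have "v \<in> leaves T'"
  proof -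
    have "out_arcs T' v = {e'}" using Tv e e' neq by (auto simp: out_arcs_def)
    then show ?thesis by (simp add: leaves_def out_degree_def)
  qed
  moreover have "x \<in> leaves T'" if "x \<in> leaves T" "x \<noteq> u" for x
  proof -
    have "x \<noteq> v" using that v by (auto simp: leaves_def)
    then have "out_arcs T' x = out_arcs T x" using that e e' comp by (auto simp: out_arcs_def)
    then show ?thesis using that by (simp add: leaves_def out_degree_def)
  qed
  ultimately show ?thesis
    using graph' conn' sub' by (intro exI[of _ T']) (auto simp: undirected_tree_def)
qed

text \<open>As long as a node is missing, connectedness of \<open>A\<close> provides an edge from
  the tree to a missing node. Adding it makes a new leaf and destroys at most one, so the number of
  leaves never drops.\<close>

lemma undirected_tree_extend:
  fixes X T :: "('a, 'b) pre_digraph"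
  assumes X: "graph X" and "undirected_tree T" "subgraph T X" "verts T \<subseteq> A" "A \<subseteq> verts X"
    and conn: "\<And>a b. a \<in> A \<Longrightarrow> b \<in> A \<Longrightarrow> (a, b) \<in> rtrancl_on A (arcs_ends X)"
  shows "\<exists>T'. undirected_tree T' \<and> subgraph T' X \<and> verts T' = A \<and>
           card (leaves T) \<le> card (leaves T')"
  using assms(2-4)
proof (induction "card (A - verts T)" arbitrary: T rule: less_induct)
  case less
  interpret X: graph X by (rule X)
  have finA: "finite A" using assms(5) X.finite_verts by (rule finite_subset)
  show ?case
  proof (cases "verts T = A")
    case True
    then show ?thesis using less.prems by auto
  next
    case False
    then obtain b where b: "b \<in> A" "b \<notin> verts T" using less.prems by auto
    obtain a where a: "a \<in> verts T"
      using less.prems by (auto simp: undirected_tree_def connected_conv)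
    have "(a, b) \<in> rtrancl_on A (arcs_ends X)" using conn a b less.prems by auto
    \<comment> \<open>A walk inside \<open>A\<close> from the tree to \<open>b\<close> crosses out
      of the tree at some edge.\<close>
    then have "b \<in> verts T \<or> (\<exists>u v. u \<in> verts T \<and> v \<in> A - verts T \<and> (u, v) \<in> arcs_ends X)"
      by (induction rule: rtrancl_on_induct) (use a in auto)
    then obtain u v where uv: "u \<in> verts T" "v \<in> A" "v \<notin> verts T" "(u, v) \<in> arcs_ends X"
      using b by auto
    obtain T' where T': "undirected_tree T'" "subgraph T' X" "verts T' = insert v (verts T)"
      "insert v (leaves T - {u}) \<subseteq> leaves T'"
      using undirected_tree_add_pendant[OF X less.prems(1,2) uv(1,4,3)] by auto
    have fin: "finite (leaves T')" "finite (leaves T)"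
      using finA T'(3) less.prems(3) uv(2) by (auto simp: leaves_def intro: finite_subset)
    have "v \<notin> leaves T" using uv by (auto simp: leaves_def)
    then have "card (leaves T) \<le> card (insert v (leaves T - {u}))"
      using fin by (auto simp: card_insert_if card_Diff_singleton_if)
    also have "\<dots> \<le> card (leaves T')" using T' fin by (intro card_mono) auto
    finally have "card (leaves T) \<le> card (leaves T')" .
    moreover have "card (A - verts T') < card (A - verts T)"
      using uv T'(3) finA by (intro psubset_card_mono) auto
    ultimately show ?thesis
      using less.hyps[of T'] T' uv less.prems by (metis insert_subset le_trans)
  qed
qed

text \<open>Every \<open>w\<close> is hung on a node of the original \<open>T\<close>, never on one
  attached earlier, so attached nodes keep degree one.\<close>

lemma undirected_tree_attach_leaves:
  fixes X T :: "('a, 'b) pre_digraph"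
  assumes X: "graph X" and T: "undirected_tree T" "subgraph T X"
    and W: "finite W" "W \<inter> verts T = {}" "\<And>w. w \<in> W \<Longrightarrow> \<exists>a\<in>verts T. (w, a) \<in> arcs_ends X"
  shows "\<exists>T'. undirected_tree T' \<and> subgraph T' X \<and> verts T' = verts T \<union> W \<and> W \<subseteq> leaves T'"
  using W
proof (induction W rule: finite_induct)
  case empty
  then show ?case using T by auto
next
  case (insert w W)
  interpret X: graph X by (rule X)
  obtain T' where T': "undirected_tree T'" "subgraph T' X" "verts T' = verts T \<union> W" "W \<subseteq> leaves T'"
    using insert by auto
  obtain a where a: "a \<in> verts T" "(a, w) \<in> arcs_ends X"
    using insert.prems X.graph_symmetric by blast
  have "a \<in> verts T'" "w \<notin> verts T'" using a T' insert by auto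
  from undirected_tree_add_pendant[OF X T'(1,2) this(1) a(2) this(2)]
  obtain T'' where "undirected_tree T''" "subgraph T'' X" "verts T'' = insert w (verts T')"
    "insert w (leaves T' - {a}) \<subseteq> leaves T''" by auto
  moreover have "a \<notin> W" using a insert by auto
  ultimately show ?case using T' by (intro exI[of _ T'']) auto
qed

lemma undirected_tree_singleton:
  fixes X :: "('a, 'b) pre_digraph"
  assumes "wf_digraph X" "x \<in> verts X"
  shows "\<exists>T. undirected_tree T \<and> subgraph T X \<and> verts T = {x}"
proof -
  define T where "T = \<lparr>verts = {x}, arcs = {}, tail = tail X, head = head X\<rparr>"
  have wf: "wf_digraph T" by unfold_locales (simp_all add: T_def)
  have "graph T" 
    by unfold_locales (simp_all add: T_def symmetric_def arcs_ends_def sym_def)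
  moreover have "Digraph_Component.connected T" by (auto simp: connected_conv T_def)
  moreover have "undirected_acyclic T"
    by (auto simp: undirected_acyclic_def pre_digraph.cycle_def pre_digraph.awalk_def T_def)
  moreover have "subgraph T X" using assms wf by (auto simp: subgraph_def T_def compatible_def)
  ultimately show ?thesis by (intro exI[of _ T]) (auto simp: undirected_tree_def T_def)
qed

lemma graph_connected_rtrancl_on:
  assumes "graph X" "Digraph_Component.connected X" "u \<in> verts X" "v \<in> verts X"
  shows "(u, v) \<in> rtrancl_on (verts X) (arcs_ends X)"
proof -
  interpret graph X by (rule assms(1))
  show ?thesis
    using symmetric_connected_imp_strongly_connected[OF sym_arcs assms(2)] assms(3,4)
    by (auto simp: strongly_connected_def reachable_def)
qed

section \<open>The maximum number of leaves\<close>

lemma finite_leaf_cards: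
  assumes "finite (verts X)"
  shows "finite {card (leaves T) | T. undirected_spanning_tree T X}"
proof -
  have "card (leaves T) \<le> card (verts X)" if "undirected_spanning_tree T X" for T
    using that assms
    by (intro card_mono) (auto simp: undirected_spanning_tree_def spanning_def leaves_def)
  then have "{card (leaves T) | T. undirected_spanning_tree T X} \<subseteq> {..card (verts X)}" by auto
  then show ?thesis using finite_subset by blast
qed

lemma card_leaves_le_leaf:
  assumes "finite (verts X)" "undirected_spanning_tree T X"
  shows "card (leaves T) \<le> leaf X"
  unfolding leaf_def using assms by (intro Max_ge finite_leaf_cards) auto

lemma leaf_attained:
  assumes "finite (verts X)" "undirected_spanning_tree T X"
  shows "\<exists>T'. undirected_spanning_tree T' X \<and> card (leaves T') = leaf X"
proof -
  have "leaf X \<in> {card (leaves T) | T. undirected_spanning_tree T X}"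
    unfolding leaf_def using assms by (intro Max_in finite_leaf_cards) auto
  then show ?thesis by auto
qed

text \<open>\<open>R\<close> meets every component of \<open>A\<close>. After merging into a
  connected \<open>A'\<close>, a tree on \<open>A'\<close> is grown from one node, the rest of
  \<open>W\<close> is hung on as leaves, and only then is the tree extended to all nodes, which does
  not lower the count.\<close>

lemma leaf_ge_dominated:
  fixes X :: "('a, 'b) pre_digraph"
  assumes X: "graph X" "Digraph_Component.connected X"
    and A: "R \<subseteq> A" "A \<subseteq> verts X" "A \<noteq> {}"
      "\<And>a. a \<in> A \<Longrightarrow> \<exists>r\<in>R. (a, r) \<in> rtrancl_on A (arcs_ends X)"
    and W: "W \<inter> A = {}" "\<And>w. w \<in> W \<Longrightarrow> \<exists>a\<in>A. (w, a) \<in> arcs_ends X"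
  shows "card W \<le> leaf X + 2 * (card R - 1)"
proof -
  interpret X: graph X by (rule X)
  have WV: "W \<subseteq> verts X" using W(2) X.adj_in_verts by blast
  have finR: "finite R" using A finite_subset X.finite_verts by metis
  have finW: "finite W" using WV finite_subset X.finite_verts by metis
  have "\<exists>A'. A \<subseteq> A' \<and> A' \<subseteq> verts X \<and> (\<forall>a\<in>A'. \<forall>b\<in>A'. (a, b) \<in> rtrancl_on A' (arcs_ends X)) \<and>
           card (W - A) \<le> card (W - A') + 2 * (card R - 1)"
  proof (rule merge_classes)
    show "sym (arcs_ends X)" using X.sym_arcs by (simp add: symmetric_def)
    show "arcs_ends X \<subseteq> verts X \<times> verts X" using X.adj_in_verts by auto
    show "(u, v) \<in> (arcs_ends X)\<^sup>*" if "u \<in> verts X" "v \<in> verts X" for u v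
      using graph_connected_rtrancl_on[OF X that] by (rule rtrancl_on_rtranclI)
  qed (use A W finR finW in auto)
  then obtain A' where A': "A \<subseteq> A'" "A' \<subseteq> verts X"
    "\<And>a b. a \<in> A' \<Longrightarrow> b \<in> A' \<Longrightarrow> (a, b) \<in> rtrancl_on A' (arcs_ends X)"
    "card (W - A) \<le> card (W - A') + 2 * (card R - 1)" by auto
  obtain x where x: "x \<in> A'" using A(3) A'(1) by auto
  obtain T0 where T0: "undirected_tree T0" "subgraph T0 X" "verts T0 = {x}"
    using undirected_tree_singleton[OF X.wf_digraph, of x] x A' by auto
  obtain T1 where T1: "undirected_tree T1" "subgraph T1 X" "verts T1 = A'"
    using undirected_tree_extend[OF X(1) T0(1,2) _ A'(2,3)] x T0(3) by auto
  have "\<exists>T'. undirected_tree T' \<and> subgraph T' X \<and> verts T' = verts T1 \<union> (W - A') \<and>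
      W - A' \<subseteq> leaves T'"
    using T1 finW W(2) A'(1) by (intro undirected_tree_attach_leaves X) auto
  then obtain T2 where T2: "undirected_tree T2" "subgraph T2 X" "verts T2 = A' \<union> (W - A')"
    "W - A' \<subseteq> leaves T2" using T1 by auto
  have "verts T2 \<subseteq> verts X" using T2 A' WV by auto
  then obtain T3 where T3: "undirected_tree T3" "subgraph T3 X" "verts T3 = verts X"
    "card (leaves T2) \<le> card (leaves T3)"
    using undirected_tree_extend[OF X(1) T2(1,2) _ _ graph_connected_rtrancl_on[OF X]] by auto
  have "finite (leaves T2)"
    using \<open>verts T2 \<subseteq> verts X\<close> X.finite_verts by (auto simp: leaves_def intro: finite_subset)
  then have "card (W - A') \<le> card (leaves T2)" using T2 by (intro card_mono) auto
  moreover have "card (leaves T3) \<le> leaf X"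
    using T3 by (intro card_leaves_le_leaf)
      (auto simp: undirected_spanning_tree_def spanning_def)
  moreover have "W - A = W" using W by auto
  ultimately show ?thesis using A'(4) T3(4) by simp
qed

section \<open>Sparsification\<close>

text \<open>A leaf is a dead end: a walk through it returns to where it came from, so the detour can
  be cut out. Two adjacent leaves would form a component by themselves, impossible with three
  nodes.\<close>

lemma nonleaves_connected_dominating:
  fixes T :: "('a, 'b) pre_digraph"
  assumes T: "graph T" "Digraph_Component.connected T" and card: "3 \<le> card (verts T)"
  defines "I \<equiv> verts T - leaves T"
  shows "v \<in> leaves T \<Longrightarrow> \<exists>a\<in>I. (v, a) \<in> arcs_ends T"
    and "a \<in> I \<Longrightarrow> b \<in> I \<Longrightarrow> (a, b) \<in> rtrancl_on I (arcs_ends T)"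
    and "I \<noteq> {}"
proof -
  interpret T: graph T by (rule T)
  have unique: "y = z" if x: "x \<in> leaves T" and "(x, y) \<in> arcs_ends T" "(x, z) \<in> arcs_ends T" for x y z
  proof -
    obtain e where "out_arcs T x = {e}"
      using x card_1_singletonE[of "out_arcs T x"] by (auto simp: leaves_def out_degree_def)
    then have "a = e" if "a \<in> arcs T" "tail T a = x" for a using that by (auto simp: set_eq_iff)
    then show ?thesis using \<open>(x, y) \<in> _\<close> \<open>(x, z) \<in> _\<close> by (metis reachableE)
  qed
  have not_both: "y \<notin> leaves T" if xy: "x \<in> leaves T" "(x, y) \<in> arcs_ends T" for x y
  proof
    assume y: "y \<in> leaves T"
    have yx: "(y, x) \<in> arcs_ends T" using xy(2) by (rule T.graph_symmetric)
    have "z \<in> {x, y}" if "(x, z) \<in> rtrancl_on (verts T) (arcs_ends T)" for z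
      using that
    proof (induction rule: rtrancl_on_induct)
      case (step z w)
      then show ?case using unique[OF xy, of w] unique[OF y yx, of w] by blast
    qed simp
    moreover have "x \<in> verts T" using xy T.adj_in_verts by auto
    ultimately have "verts T \<subseteq> {x, y}" using graph_connected_rtrancl_on[OF T] by blast
    then have "card (verts T) \<le> card {x, y}" by (intro card_mono) auto
    also have "\<dots> \<le> 2" by (simp add: card_insert_if)
    finally show False using card by simp
  qed
  show dom: "\<exists>a\<in>I. (v, a) \<in> arcs_ends T" if v: "v \<in> leaves T" for v
  proof -
    obtain e where "out_arcs T v = {e}"
      using v card_1_singletonE[of "out_arcs T v"] by (auto simp: leaves_def out_degree_def)
    then have "e \<in> arcs T" "tail T e = v" by (auto simp: set_eq_iff)
    then have "(v, head T e) \<in> arcs_ends T" by (auto simp: arcs_ends_conv)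
    then show ?thesis using not_both[OF v] T.adj_in_verts unfolding I_def by blast
  qed
  have "verts T \<noteq> {}" using card by auto
  then show "I \<noteq> {}" using dom unfolding I_def by blast
  show "(a, b) \<in> rtrancl_on I (arcs_ends T)" if ab: "a \<in> I" "b \<in> I" for a b
  proof -
    have "(a, b) \<in> rtrancl_on (verts T) (arcs_ends T)"
      using graph_connected_rtrancl_on[OF T] ab by (auto simp: I_def)
    \<comment> \<open>Strengthened for induction along the walk: at a leaf, it is the neighbours of
      the leaf that are already reached within \<open>I\<close>.\<close>
    then have "(b \<in> I \<longrightarrow> (a, b) \<in> rtrancl_on I (arcs_ends T)) \<and>
      (b \<in> leaves T \<longrightarrow> (\<forall>c. (b, c) \<in> arcs_ends T \<longrightarrow> (a, c) \<in> rtrancl_on I (arcs_ends T)))"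
    proof (induction rule: rtrancl_on_induct)
      case base
      then show ?case using ab by (auto simp: I_def)
    next
      case (step y z)
      have zy: "(z, y) \<in> arcs_ends T" using step T.graph_symmetric by auto
      show ?case
      proof (cases "z \<in> leaves T")
        case True
        then have "y \<in> I" using not_both[OF True zy] step by (auto simp: I_def)
        then show ?thesis using step True unique[OF True zy] by (auto simp: I_def)
      next
        case False
        then have "z \<in> I" using step by (simp add: I_def)
        then have "(a, z) \<in> rtrancl_on I (arcs_ends T)"
          using step by (cases "y \<in> leaves T") (auto simp: I_def intro: rtrancl_on_into_rtrancl_on)
        then show ?thesis using False by simp
      qed
    qed
    then show ?thesis using ab by simp
  qed
qed

section \<open>Neighbourhood sizes, low-degree nodes and the numerical estimate\<close>

lemma (in digraph) card_closed_neighbourhood: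
  "card (insert x {y. (x, y) \<in> arcs_ends G}) = Suc (out_degree G x)"
proof -
  have eq: "{y. (x, y) \<in> arcs_ends G} = head G ` out_arcs G x"
    by (auto simp: arcs_ends_conv image_iff)
  have "inj_on (head G) (out_arcs G x)"
    using no_multi_arcs by (auto simp: inj_on_def arc_to_ends_def)
  then have "card {y. (x, y) \<in> arcs_ends G} = out_degree G x"
    by (simp add: eq card_image out_degree_def)
  moreover have "finite {y. (x, y) \<in> arcs_ends G}" using eq finite_out_arcs by simp
  moreover have "(x, x) \<notin> arcs_ends G" using adj_not_same by blast
  ultimately show ?thesis by simp
qed

text \<open>Up to the threshold \<open>k\<close> the required minimum is the full degree in
  \<open>G\<close>, so no arc at \<open>x\<close> can be missing. This keeps tree edges with a
  low-degree end alive.\<close>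

lemma min_degree_subgraph_out_arcs:
  assumes "graph G" "min_degree_subgraph k S G" "x \<in> verts G" "out_degree G x \<le> k"
  shows "out_arcs S x = out_arcs G x"
proof -
  interpret G: graph G by (rule assms)
  have "subgraph S G" using assms by (auto simp: min_degree_subgraph_def spanning_def)
  then have "out_arcs S x \<subseteq> out_arcs G x"
    by (auto simp: subgraph_def compatible_def)
  moreover have "out_degree G x \<le> out_degree S x"
    using assms by (auto simp: min_degree_subgraph_def)
  ultimately show ?thesis
    using G.finite_out_arcs by (intro card_seteq) (auto simp: out_degree_def)
qed

text \<open>Lets \<open>9 * card D\<close> be absorbed into \<open>card U\<close>. The value at
  \<open>187\<close> comes from \<open>ln 187 \<le> 6\<close>, and the tangent bound for
  \<open>ln\<close> carries it to larger \<open>d\<close>.\<close>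

lemma ln_bound_187:
  fixes d :: real
  assumes "187 \<le> d"
  shows "9 * ((2 + ln d) / d) \<le> 2 / 5"
proof -
  \<comment> \<open>\<open>(5 / 2) ^ 6\<close> is about 244, which exceeds 187.\<close>
  have "(5 / 2 :: real) \<le> exp 1" using exp_lower_Taylor_quadratic[of 1] by simp
  then have "(5 / 2 :: real) ^ 6 \<le> exp 1 ^ 6" by (intro power_mono) auto
  also have "exp 1 ^ 6 = exp (6 :: real)" by (simp flip: exp_of_nat_mult)
  finally have "187 \<le> exp (6 :: real)" by (simp add: power_divide)
  then have "ln 187 \<le> (6 :: real)" using ln_le_cancel_iff[of 187 "exp 6"] by simp
  moreover have "ln (d / 187) \<le> d / 187 - 1" using assms by (intro ln_le_minus_one) auto
  moreover have "ln (d / 187) = ln d - ln 187" using assms by (simp add: ln_div)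
  ultimately have "ln d \<le> 5 + d / 187" by simp
  then have "9 * (2 + ln d) \<le> 2 / 5 * d" using assms by (simp add: field_simps)
  then show ?thesis using assms by (simp add: field_simps)
qed

text \<open>Each node of \<open>A\<close> represents itself: joining costs less than
  \<open>2 * card A\<close>, and the members of \<open>W\<close> inside \<open>A\<close> cost at
  most \<open>card A\<close> more.\<close>

lemma leaf_ge_star_cover:
  fixes X :: "('a, 'b) pre_digraph"
  assumes X: "graph X" "Digraph_Component.connected X" and A: "A \<subseteq> verts X" "A \<noteq> {}"
    and W: "\<And>w. w \<in> W \<Longrightarrow> w \<in> A \<or> (\<exists>a\<in>A. (w, a) \<in> arcs_ends X)"
  shows "card W \<le> leaf X + 3 * card A"
proof -
  interpret X: graph X by (rule X)
  have finA: "finite A" using A X.finite_verts finite_subset by metis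
  have "card (W - A) \<le> leaf X + 2 * (card A - 1)"
  proof (rule leaf_ge_dominated[OF X, of A A])
    show "\<exists>r\<in>A. (a, r) \<in> rtrancl_on A (arcs_ends X)" if "a \<in> A" for a using that by blast
    show "\<exists>a\<in>A. (w, a) \<in> arcs_ends X" if "w \<in> W - A" for w using W that by auto
  qed (use A in auto)
  moreover have "card W - card A \<le> card (W - A)" using finA by (rule diff_card_le_card_Diff)
  ultimately show ?thesis by linarith
qed

text \<open>Both graphs inherit their arcs and end maps from \<open>G\<close>, so their union
  creates neither loops nor parallel arcs.\<close>

lemma graph_union_spanning:
  assumes G: "graph G" and S: "graph S" "spanning S G" and T: "graph T" "spanning T G"
  shows "graph (union S T)" "arcs_ends (union S T) = arcs_ends S \<union> arcs_ends T"
    "verts (union S T) = verts G" "spanning T (union S T)"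
proof -
  interpret G: graph G by (rule G)
  interpret S: graph S by (rule S)
  interpret T: graph T by (rule T)
  have comp: "tail S = tail G" "head S = head G" "tail T = tail G" "head T = head G"
    "arcs S \<subseteq> arcs G" "arcs T \<subseteq> arcs G" "verts S = verts G" "verts T = verts G"
    using S(2) T(2) by (auto simp: spanning_def subgraph_def compatible_def)
  show vs: "verts (union S T) = verts G" using comp by (simp add: union_def)
  show ends: "arcs_ends (union S T) = arcs_ends S \<union> arcs_ends T"
    using comp by (auto simp: arcs_ends_conv union_def)
  have simps: "arcs (union S T) = arcs S \<union> arcs T" "tail (union S T) = tail G"
    "head (union S T) = head G" using comp by (simp_all add: union_def)
  have wf: "wf_digraph (union S T)"
    using comp by unfold_locales (auto simp: simps vs)
  then interpret H: wf_digraph "union S T" .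
  have "symmetric (union S T)"
    using S.graph_symmetric T.graph_symmetric by (auto simp: symmetric_def ends sym_def)
  then show "graph (union S T)"
    using comp G.no_loops G.no_multi_arcs G.finite_verts S.finite_arcs T.finite_arcs
    by unfold_locales (auto simp: simps vs arc_to_ends_def subset_iff)
  show "spanning T (union S T)"
    using wf T.wf_digraph comp by (auto simp: spanning_def subgraph_def compatible_def simps vs)
qed

theorem theorem6:
  fixes G S T :: "('a, 'b) pre_digraph" and k :: nat
  assumes "186 \<le> k"
    and "graph G" and "Digraph_Component.connected G"
    and "min_degree_subgraph k S G"
    and "undirected_spanning_tree T G"
  shows "real (leaf (union S T)) \<ge>
           (1 - 30 * ((1 + ln (real k + 1)) / (real k + 1))) * real (leaf G)"
proof -
  interpret G: graph G by (rule assms(2))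
  have S: "graph S" "spanning S G" using assms(4) by (auto simp: min_degree_subgraph_def)
  have T: "graph T" "Digraph_Component.connected T" "spanning T G"
    using assms(5) by (auto simp: undirected_spanning_tree_def undirected_tree_def)
  interpret S: graph S by (rule S)
  let ?H = "union S T"
  note H = graph_union_spanning[OF assms(2) S T(1,3)]
  interpret H: graph ?H by (rule H)
  have connH: "Digraph_Component.connected ?H"
    using H.connected_spanning_imp_connected[OF H(4) T(2)] .
  have vS: "verts S = verts G" using S by (simp add: spanning_def)
  have SG: "arcs S \<subseteq> arcs G" "tail S = tail G" "head S = head G" "arcs_ends S \<subseteq> arcs_ends G"
    using S(2) by (auto simp: spanning_def subgraph_def compatible_def arcs_ends_conv)
  \<comment> \<open>A node of degree more than \<open>k\<close> in \<open>G\<close> has a closed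
    neighbourhood of at least \<open>k + 1\<close> nodes in \<open>S\<close>.\<close>
  define d where "d = Suc k"
  define h where "h = (2 + ln (real d)) / real d"
  define L where "L = leaf G"
  have d: "187 \<le> real d" "real d = real k + 1" using assms(1) by (auto simp: d_def)
  have ln0: "1 \<le> ln (real d)"
  proof -
    have "exp 1 \<le> real d" using d(1) exp_le by linarith
    then show ?thesis using d(1) ln_ge_iff by auto
  qed
  define B where "B = {x \<in> verts G. k < out_degree G x}"
  show ?thesis
  proof (cases "B = {}")
    case True
    \<comment> \<open>Without nodes of large degree \<open>S\<close> keeps every arc, the union is
      \<open>G\<close> itself, and the factor is at most 1.\<close>
    have "out_arcs S x = out_arcs G x" if "x \<in> verts G" for x
      using min_degree_subgraph_out_arcs[OF assms(2,4) that] True that by (force simp: B_def)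
    then have "arcs G \<subseteq> arcs S" using G.tail_in_verts by (metis in_out_arcs_conv subsetI)
    moreover have "arcs T \<subseteq> arcs G" "verts T = verts G"
      using T(3) by (auto simp: spanning_def subgraph_def)
    ultimately have "?H = G" using SG vS by (simp add: union_def Un_absorb2)
    moreover have "0 \<le> 30 * ((1 + ln (real k + 1)) / (real k + 1))" using d ln0 by simp
    ultimately show ?thesis by (simp add: mult_left_le_one_le left_diff_distrib)
  next
    case False
    \<comment> \<open>Hitting every such neighbourhood means dominating \<open>B\<close> within
      \<open>S\<close>, whose edges are all present in the union.\<close>
    define F where "F x = insert x {y. (x, y) \<in> arcs_ends S}" for x
    define U where "U = (\<Union>x\<in>B. F x)"
    have BV: "B \<subseteq> verts G" and finB: "finite B" by (auto simp: B_def)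
    have UV: "U \<subseteq> verts G" using BV vS S.adj_in_verts by (auto simp: U_def F_def)
    then have finU: "finite U" using G.finite_verts finite_subset by metis
    have BU: "B \<subseteq> U" by (auto simp: U_def F_def)
    have degF: "d \<le> card (F x)" if "x \<in> B" for x
    proof -
      have "min (out_degree G x) k \<le> out_degree S x"
        using assms(4) that by (auto simp: min_degree_subgraph_def B_def)
      then show ?thesis
        using that S.card_closed_neighbourhood[of x] by (auto simp: F_def d_def B_def)
    qed
    have "\<exists>D\<subseteq>U. (\<forall>x\<in>B. F x \<inter> D \<noteq> {}) \<and>
        real (card D) \<le> real (card U) * ((2 + ln (real d)) / real d)"
      using degF finU finB False card_mono[OF finU BU]
      by (intro hitting_set_log_bound) (auto simp: U_def d_def)
    then obtain D where D: "D \<subseteq> U" "\<forall>x\<in>B. F x \<inter> D \<noteq> {}" "real (card D) \<le> real (card U) * h"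
      by (auto simp: h_def)
    have DV: "D \<subseteq> verts G" and finD: "finite D" using D UV finU finite_subset by auto
    have dom: "x \<in> D \<or> (\<exists>a\<in>D. (x, a) \<in> arcs_ends S)" if "x \<in> B" for x
      using D(2) that by (auto simp: F_def)
    have "D \<noteq> {}" using dom False by auto
    then have "card B \<le> L + 3 * card D"
      unfolding L_def using dom DV SG(4) by (intro leaf_ge_star_cover assms) blast+
    moreover have "card U \<le> L + 3 * card B"
      unfolding L_def
    proof (intro leaf_ge_star_cover assms BV False)
      fix w assume "w \<in> U"
      then show "w \<in> B \<or> (\<exists>a\<in>B. (w, a) \<in> arcs_ends G)"
        using SG(4) G.graph_symmetric by (auto simp: U_def F_def)
    qed
    \<comment> \<open>\<open>card D\<close> is in turn at most \<open>card U * h\<close>; as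
      \<open>9 * h \<le> 2 / 5\<close>, it is absorbed on the left, leaving
      \<open>3 / 5 * card U \<le> 4 * L\<close>.\<close>
    ultimately have "card U \<le> 4 * L + 9 * card D" by linarith
    then have "real (card U) \<le> 4 * real L + 9 * real (card D)"
      by (metis (mono_tags) of_nat_add of_nat_le_iff of_nat_mult of_nat_numeral)
    also have "\<dots> \<le> 4 * real L + real (card U) * (9 * h)" using D(3) by simp
    also have "\<dots> \<le> 4 * real L + real (card U) * (2 / 5)"
      using ln_bound_187[OF d(1)] by (intro add_left_mono mult_left_mono) (auto simp: h_def)
    finally have U: "3 * real (card U) \<le> 20 * real L" by simp
    have h0: "0 \<le> h" using ln0 d by (simp add: h_def)
    have "3 * real (card D) \<le> (3 * real (card U)) * h" using D(3) by simp
    also have "\<dots> \<le> (20 * real L) * h" using U h0 by (rule mult_right_mono)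
    also have "\<dots> = (20 * (2 + ln (real d)) / real d) * real L" by (simp add: h_def)
    \<comment> \<open>\<open>20 * (2 + x) \<le> 30 * (1 + x)\<close> exactly when
      \<open>1 \<le> x\<close>; this is where the \<open>30\<close> comes from.\<close>
    also have "\<dots> \<le> (30 * (1 + ln (real d)) / real d) * real L"
      using ln0 d by (intro mult_right_mono divide_right_mono) auto
    finally have D3: "3 * real (card D) \<le> 30 * ((1 + ln (real d)) / real d) * real L" by simp

    \<comment> \<open>An optimal tree of \<open>G\<close>; the union may lack some of its edges, but
      only those with both ends in \<open>B\<close>.\<close>
    obtain T' where T': "undirected_spanning_tree T' G" "card (leaves T') = L"
      using leaf_attained[OF _ assms(5)] by (auto simp: L_def)
    have gT': "graph T'" "Digraph_Component.connected T'" and vT': "verts T' = verts G"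
      and T'G: "arcs_ends T' \<subseteq> arcs_ends G"
      using T'(1) by (auto simp: undirected_spanning_tree_def undirected_tree_def spanning_def
          subgraph_def compatible_def arcs_ends_conv)
    interpret T': graph T' by (rule gT')
    have "3 \<le> card (verts T')"
    proof -
      obtain b where "b \<in> B" using False by auto
      then have "d \<le> card (F b)" "F b \<subseteq> U"
        using degF by (auto simp: U_def)
      then have "d \<le> card (verts G)" using UV G.finite_verts by (meson card_mono le_trans subset_trans)
      then show ?thesis using vT' assms(1) by (simp add: d_def)
    qed
    note skel = nonleaves_connected_dominating[OF gT' this]
    define I where "I = verts T' - leaves T'"
    have light: "(x, y) \<in> arcs_ends ?H" if "(x, y) \<in> arcs_ends T'" "x \<notin> B" for x y
    proof -
      have "(x, y) \<in> arcs_ends G" using that T'G by auto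
      then obtain e where e: "e \<in> out_arcs G x" "head G e = y" by (auto simp: arcs_ends_conv)
      have "x \<in> verts G" using \<open>(x, y) \<in> arcs_ends G\<close> G.adj_in_verts by auto
      then have "e \<in> out_arcs S x"
        using min_degree_subgraph_out_arcs[OF assms(2,4), of x] that(2) e by (auto simp: B_def)
      then have "(x, y) \<in> arcs_ends S" using e SG by (auto simp: arcs_ends_conv)
      then show ?thesis using H(2) by simp
    qed
    have domH: "x \<in> D \<or> (\<exists>a\<in>D. (x, a) \<in> arcs_ends ?H)" if "x \<in> B" for x
      using dom[OF that] H(2) by auto
    obtain a0 where a0: "a0 \<in> I" using skel(3) by (auto simp: I_def)
    \<comment> \<open>\<open>I\<close> still dominates the leaves outside \<open>B\<close>, and
      \<open>D\<close> takes over those in \<open>B\<close>. Every component of \<open>?A\<close>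
      meets \<open>D\<close> or contains \<open>a0\<close>, so \<open>?R\<close> represents them
      all.\<close>
    let ?A = "I \<union> D" and ?R = "insert a0 D"
    have "card (verts G - ?A) \<le> leaf ?H + 2 * (card ?R - 1)"
    proof (rule leaf_ge_dominated[OF H(1) connH])
      show "?R \<subseteq> ?A" "?A \<noteq> {}" using a0 by auto
      show "?A \<subseteq> verts ?H" using vT' DV H(3) by (auto simp: I_def)
      show "(verts G - ?A) \<inter> ?A = {}" by auto
      show "\<exists>a\<in>?A. (w, a) \<in> arcs_ends ?H" if "w \<in> verts G - ?A" for w
      proof (cases "w \<in> B")
        case True then show ?thesis using domH[of w] that by auto
      next
        case False
        have "w \<in> leaves T'" using that vT' by (auto simp: I_def)
        then show ?thesis using skel(1) light False unfolding I_def by blast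
      qed
      fix a assume a: "a \<in> ?A"
      show "\<exists>r\<in>?R. (a, r) \<in> rtrancl_on ?A (arcs_ends ?H)"
      proof (cases "\<exists>r\<in>D. (a, r) \<in> rtrancl_on ?A (arcs_ends ?H)")
        case True
        then show ?thesis by auto
      next
        case no_D: False
        then have "a \<in> I" using a by auto
        \<comment> \<open>The component of \<open>a\<close> avoids \<open>D\<close>, hence all high-degree vertices, so every edge of
          \<open>T'\<close> leaving it survives in the union.\<close>
        have "(a, a0) \<in> rtrancl_on I (arcs_ends T')"
          using skel(2) \<open>a \<in> I\<close> a0 by (simp add: I_def)
        then have "(a, a0) \<in> rtrancl_on ?A (arcs_ends ?H)"
        proof (induction rule: rtrancl_on_induct)
          case base
          then show ?case by auto
        next
          case (step y z)
          have "y \<notin> B"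
          proof
            assume "y \<in> B"
            then show False
              using domH[of y] step.IH no_D by (blast intro: rtrancl_on_into_rtrancl_on)
          qed
          then show ?case
            using step light by (auto intro: rtrancl_on_into_rtrancl_on)
        qed
        then show ?thesis by auto
      qed
    qed
    \<comment> \<open>The extra representative \<open>a0\<close> is offset by the
      \<open>- 1\<close>, so joining costs at most \<open>2 * card D\<close>.\<close>
    moreover have "card ?R - 1 \<le> card D" using finD by (simp add: card_insert_if)
    \<comment> \<open>Leaves of \<open>T'\<close> lie outside \<open>I\<close>; at most
      \<open>card D\<close> of them are used up by \<open>D\<close>.\<close>
    moreover have "L \<le> card (verts G - ?A) + card D"
    proof -
      have "leaves T' \<subseteq> (verts G - ?A) \<union> D" using vT' by (auto simp: I_def leaves_def)
      then have "card (leaves T') \<le> card ((verts G - ?A) \<union> D)"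
        using finD by (intro card_mono) auto
      then show ?thesis using T'(2) card_Un_le le_trans by metis
    qed
    ultimately have "L \<le> leaf ?H + 3 * card D" by linarith
    then have "real L \<le> real (leaf ?H) + 3 * real (card D)"
      by (metis (mono_tags) of_nat_add of_nat_le_iff of_nat_mult of_nat_numeral)
    then show ?thesis using D3 by (simp add: d(2) L_def algebra_simps)
  qed
qed

end
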